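(* Let $R:\mathsf{DSNC}\to\mathsf{FinPos}$ send a DSNC $(E,\mathrm{dep})$ to the set $E$ with the partial order $e'\le e$ iff $e'=e$ or $e'\in\mathrm{dep}(e)$, and let $R^{-1}:\mathsf{FinPos}\to\mathsf{DSNC}$ send a finite poset $P$ to the DSNC with underlying set $P$ in which $b\in\mathrm{dep}(a)$ iff $b<a$; both act as the identity on underlying functions of morphisms. (Here $\mathrm{dep}(e)$ also denotes the unique depset of $e$.) Then $R$ and $R^{-1}$ form an isomorphism of categories $\mathsf{DSNC}\cong\mathsf{FinPos}$.
   Context: $P(A)$ denotes the power set of $A$. A preDSC is a pair $(E,\mathrm{dep})$ with $E$ a finite set and $\mathrm{dep}:E\to P(P(E))$ a function; elements of $\mathrm{dep}(e)$ are called depsets of $e$. For $X,Y\subseteq E$ write $X\,\mathrm{rch}\,Y$ if $X\subseteq Y$ and for every $y\in Y$ there is $D\in\mathrm{dep}(y)$ with $D\subseteq X$. A subset $X\subseteq E$ is reachable if there is a finite sequence of subsets with $\varnothing\,\mathrm{rch}\,X_0\,\mathrm{rch}\cdots\mathrm{rch}\,X_n\,\mathrm{rch}\,X$. A subset $X$ is complete if every $e\in X$ has a depset $D\in\mathrm{dep}(e)$ with $D\subseteq X$. A DSC is a preDSC which is irredundant ($D_0\subseteq D_1$ with $D_0,D_1\in\mathrm{dep}(e)$ implies $D_0=D_1$), acyclic ($e\notin D$ for all $D\in\mathrm{dep}(e)$), nonsingular ($\mathrm{dep}(e)\neq\varnothing$ for all $e$) and has complete depsets (all $D\in\mathrm{dep}(e)$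 are complete). A morphism of DSCs is a function $f:E\to E'$ such that $f^{-1}(X)$ is reachable for every reachable $X\subseteq E'$. A DSNC is a DSC such that $\mathrm{dep}(e)$ is a singleton for every $e\in E$; its unique element is also written $\mathrm{dep}(e)$. $\mathsf{DSNC}$ is the full subcategory of the category of DSCs on the DSNCs. $\mathsf{FinPos}$ is the category of finite posets and order-preserving maps. *)

theory Defs
  imports Main "HOL-Library.FuncSet"
begin

section \<open>Categories and functors\<close>

text \<open>
  Categories are given by hom-sets, which need not be disjoint. For this reason identities,
  composition and the action of a functor on morphisms carry the objects involved as arguments:
  \<open>cmp C X Y Z g f\<close> is the composite of \<open>f : X \<rightarrow> Y\<close> and \<open>g : Y \<rightarrow> Z\<close>.
\<close>

record ('o, 'm) cat =
  obj :: "'o set"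
  hom :: "'o \<Rightarrow> 'o \<Rightarrow> 'm set"
  ide :: "'o \<Rightarrow> 'm"
  cmp :: "'o \<Rightarrow> 'o \<Rightarrow> 'o \<Rightarrow> 'm \<Rightarrow> 'm \<Rightarrow> 'm"

definition is_category :: "('o, 'm) cat \<Rightarrow> bool" where
  "is_category C \<longleftrightarrow>
     (\<forall>X\<in>obj C. ide C X \<in> hom C X X) \<and>
     (\<forall>X\<in>obj C. \<forall>Y\<in>obj C. \<forall>Z\<in>obj C. \<forall>f\<in>hom C X Y. \<forall>g\<in>hom C Y Z.
        cmp C X Y Z g f \<in> hom C X Z) \<and>
     (\<forall>X\<in>obj C. \<forall>Y\<in>obj C. \<forall>f\<in>hom C X Y.
        cmp C X X Y f (ide C X) = f \<and> cmp C X Y Y (ide C Y) f = f) \<and>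
     (\<forall>W\<in>obj C. \<forall>X\<in>obj C. \<forall>Y\<in>obj C. \<forall>Z\<in>obj C.
        \<forall>f\<in>hom C W X. \<forall>g\<in>hom C X Y. \<forall>h\<in>hom C Y Z.
        cmp C W Y Z h (cmp C W X Y g f) = cmp C W X Z (cmp C X Y Z h g) f)"

definition full_subcategory :: "('o, 'm) cat \<Rightarrow> 'o set \<Rightarrow> ('o, 'm) cat" where
  "full_subcategory C S =
     \<lparr>obj = obj C \<inter> S, hom = hom C, ide = ide C, cmp = cmp C\<rparr>"

record ('o, 'm, 'p, 'n) func =
  on_obj :: "'o \<Rightarrow> 'p"
  on_mor :: "'o \<Rightarrow> 'o \<Rightarrow> 'm \<Rightarrow> 'n"

definition is_functor :: "('o, 'm) cat \<Rightarrow> ('p, 'n) cat \<Rightarrow> ('o, 'm, 'p, 'n) func \<Rightarrow> bool" where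
  "is_functor C D F \<longleftrightarrow>
     is_category C \<and> is_category D \<and>
     (\<forall>X\<in>obj C. on_obj F X \<in> obj D) \<and>
     (\<forall>X\<in>obj C. \<forall>Y\<in>obj C. \<forall>f\<in>hom C X Y.
        on_mor F X Y f \<in> hom D (on_obj F X) (on_obj F Y)) \<and>
     (\<forall>X\<in>obj C. on_mor F X X (ide C X) = ide D (on_obj F X)) \<and>
     (\<forall>X\<in>obj C. \<forall>Y\<in>obj C. \<forall>Z\<in>obj C. \<forall>f\<in>hom C X Y. \<forall>g\<in>hom C Y Z.
        on_mor F X Z (cmp C X Y Z g f) =
        cmp D (on_obj F X) (on_obj F Y) (on_obj F Z) (on_mor F Y Z g) (on_mor F X Y f))"

definition id_functor :: "('o, 'm, 'o, 'm) func" where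
  "id_functor = \<lparr>on_obj = (\<lambda>X. X), on_mor = (\<lambda>X Y f. f)\<rparr>"

definition comp_functor ::
  "('p, 'n, 'q, 'k) func \<Rightarrow> ('o, 'm, 'p, 'n) func \<Rightarrow> ('o, 'm, 'q, 'k) func" where
  "comp_functor G F =
     \<lparr>on_obj = (\<lambda>X. on_obj G (on_obj F X)),
      on_mor = (\<lambda>X Y f. on_mor G (on_obj F X) (on_obj F Y) (on_mor F X Y f))\<rparr>"

text \<open>Functors are total functions in HOL, so they are compared on the source category only.\<close>

definition eq_functor ::
  "('o, 'm) cat \<Rightarrow> ('o, 'm, 'p, 'n) func \<Rightarrow> ('o, 'm, 'p, 'n) func \<Rightarrow> bool" where
  "eq_functor C F G \<longleftrightarrow>
     (\<forall>X\<in>obj C. on_obj F X = on_obj G X) \<and>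
     (\<forall>X\<in>obj C. \<forall>Y\<in>obj C. \<forall>f\<in>hom C X Y. on_mor F X Y f = on_mor G X Y f)"

definition isomorphism_of_categories ::
  "('o, 'm) cat \<Rightarrow> ('p, 'n) cat \<Rightarrow> ('o, 'm, 'p, 'n) func \<Rightarrow> ('p, 'n, 'o, 'm) func \<Rightarrow> bool" where
  "isomorphism_of_categories C D F G \<longleftrightarrow>
     is_functor C D F \<and> is_functor D C G \<and>
     eq_functor C (comp_functor G F) id_functor \<and>
     eq_functor D (comp_functor F G) id_functor"

section \<open>Dependency structures with choice\<close>

type_synonym 'a predsc = "'a set \<times> ('a \<Rightarrow> 'a set set)"

text \<open>
  The value of \<open>dep\<close> outside \<open>E\<close> is fixed to \<open>undefined\<close> by \<open>\<rightarrow>\<^sub>E\<close>, so that equality of pairs is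
  equality of preDSCs. The same device is used for morphisms.
\<close>

definition is_predsc :: "'a predsc \<Rightarrow> bool" where
  "is_predsc = (\<lambda>(E, dep). finite E \<and> dep \<in> E \<rightarrow>\<^sub>E Pow (Pow E))"

definition rch :: "'a predsc \<Rightarrow> 'a set \<Rightarrow> 'a set \<Rightarrow> bool" where
  "rch = (\<lambda>(E, dep) X Y. X \<subseteq> E \<and> Y \<subseteq> E \<and> X \<subseteq> Y \<and> (\<forall>y\<in>Y. \<exists>D\<in>dep y. D \<subseteq> X))"

definition reachable :: "'a predsc \<Rightarrow> 'a set \<Rightarrow> bool" where
  "reachable A X \<longleftrightarrow> (\<exists>Xs. Xs \<noteq> [] \<and> successively (rch A) ({} # Xs @ [X]))"

definition complete :: "'a predsc \<Rightarrow> 'a set \<Rightarrow> bool" where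
  "complete = (\<lambda>(E, dep) X. X \<subseteq> E \<and> (\<forall>e\<in>X. \<exists>D\<in>dep e. D \<subseteq> X))"

definition irredundant :: "'a predsc \<Rightarrow> bool" where
  "irredundant = (\<lambda>(E, dep). \<forall>e\<in>E. \<forall>D\<^sub>0\<in>dep e. \<forall>D\<^sub>1\<in>dep e. D\<^sub>0 \<subseteq> D\<^sub>1 \<longrightarrow> D\<^sub>0 = D\<^sub>1)"

definition acyclic_dep :: "'a predsc \<Rightarrow> bool" where
  "acyclic_dep = (\<lambda>(E, dep). \<forall>e\<in>E. \<forall>D\<in>dep e. e \<notin> D)"

definition nonsingular :: "'a predsc \<Rightarrow> bool" where
  "nonsingular = (\<lambda>(E, dep). \<forall>e\<in>E. dep e \<noteq> {})"

definition complete_depsets :: "'a predsc \<Rightarrow> bool" where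
  "complete_depsets = (\<lambda>(E, dep). \<forall>e\<in>E. \<forall>D\<in>dep e. complete (E, dep) D)"

definition is_dsc :: "'a predsc \<Rightarrow> bool" where
  "is_dsc A \<longleftrightarrow>
     is_predsc A \<and> irredundant A \<and> acyclic_dep A \<and> nonsingular A \<and> complete_depsets A"

definition is_dsnc :: "'a predsc \<Rightarrow> bool" where
  "is_dsnc A \<longleftrightarrow> is_dsc A \<and> (\<forall>e\<in>fst A. is_singleton (snd A e))"

definition dsc_hom :: "'a predsc \<Rightarrow> 'a predsc \<Rightarrow> ('a \<Rightarrow> 'a) set" where
  "dsc_hom A B =
     {f \<in> fst A \<rightarrow>\<^sub>E fst B. \<forall>X \<subseteq> fst B. reachable B X \<longrightarrow> reachable A (f -` X \<inter> fst A)}"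

definition DSC :: "('a predsc, 'a \<Rightarrow> 'a) cat" where
  "DSC =
     \<lparr>obj = {A. is_dsc A},
      hom = dsc_hom,
      ide = (\<lambda>A. \<lambda>x\<in>fst A. x),
      cmp = (\<lambda>A B C g f. compose (fst A) g f)\<rparr>"

definition DSNC :: "('a predsc, 'a \<Rightarrow> 'a) cat" where
  "DSNC = full_subcategory DSC {A. is_dsnc A}"

section \<open>Finite posets\<close>

text \<open>A poset is a pair \<open>(P, r)\<close>, where \<open>(x, y) \<in> r\<close> stands for \<open>x \<le> y\<close>.\<close>

type_synonym 'a poset = "'a set \<times> 'a rel"

definition is_finposet :: "'a poset \<Rightarrow> bool" where
  "is_finposet = (\<lambda>(P, r). finite P \<and> partial_order_on P r)"

definition poset_hom :: "'a poset \<Rightarrow> 'a poset \<Rightarrow> ('a \<Rightarrow> 'a) set" where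
  "poset_hom = (\<lambda>(P, r) (Q, s).
     {f \<in> P \<rightarrow>\<^sub>E Q. monotone_on P (\<lambda>x y. (x, y) \<in> r) (\<lambda>x y. (x, y) \<in> s) f})"

definition FinPos :: "('a poset, 'a \<Rightarrow> 'a) cat" where
  "FinPos =
     \<lparr>obj = {A. is_finposet A},
      hom = poset_hom,
      ide = (\<lambda>A. \<lambda>x\<in>fst A. x),
      cmp = (\<lambda>A B C g f. compose (fst A) g f)\<rparr>"

section \<open>The two functors\<close>

text \<open>For a DSNC, \<open>the_elem (dep e)\<close> is the unique depset of \<open>e\<close>.\<close>

definition R_functor :: "('a predsc, 'a \<Rightarrow> 'a, 'a poset, 'a \<Rightarrow> 'a) func" where
  "R_functor =
     \<lparr>on_obj = (\<lambda>(E, dep). (E, {(e', e). e' \<in> E \<and> e \<in> E \<and> (e' = e \<or> e' \<in> the_elem (dep e))})),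
      on_mor = (\<lambda>A B f. f)\<rparr>"

definition R_inv_functor :: "('a poset, 'a \<Rightarrow> 'a, 'a predsc, 'a \<Rightarrow> 'a) func" where
  "R_inv_functor =
     \<lparr>on_obj = (\<lambda>(P, r). (P, \<lambda>a\<in>P. {{b \<in> P. (b, a) \<in> r \<and> b \<noteq> a}})),
      on_mor = (\<lambda>P Q f. f)\<rparr>"

end

theory Submission
  imports Defs
begin

text \<open>
  The reachable sets of a DSC are exactly its complete sets: every step of a reaching sequence
  ends in a complete set, and conversely a complete set can be filled up one element at a time,
  because depsets are themselves complete and acyclicity makes it impossible to descend forever
  inside a finite depset. This is \<open>dsc_reachable_iff_complete\<close>.

  In a DSNC a set is complete iff it contains the depset of each of its elements, that is, iff it
  is a lower set of the order \<open>e' = e \<or> e' \<in> dep e\<close>. So a DSC morphism between DSNCs is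
  a function under which preimages of lower sets are lower sets, and such functions are exactly the
  order-preserving ones (test against principal lower sets). Hence the hom-sets of DSNCs and of
  the corresponding posets are equal, not just in bijection (\<open>dsc_hom_eq_poset_hom\<close>).

  On objects, complete depsets express transitivity of the order, and acyclicity expresses that the
  depset of \<open>e\<close> is the set of elements strictly below \<open>e\<close>. Thus the two object maps are mutually
  inverse, and as identities and composition on both sides are those of functions, nothing else
  remains to be checked.
\<close>

section \<open>Reachable sets of a DSC\<close>

lemma reachable_empty: "reachable A {}"
proof -
  obtain E dep where A: "A = (E, dep)"
    by (cases A)
  have "successively (rch A) ({} # [{}] @ [{}])"
    by (simp add: A rch_def)
  then show ?thesis
    unfolding reachable_def by blast
qed

lemma reachable_step:
  assumes "reachable A X" and "rch A X Y"
  shows "reachable A Y"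
proof -
  obtain Xs where "Xs \<noteq> []" and "successively (rch A) ({} # Xs @ [X])"
    using assms(1) unfolding reachable_def by blast
  then have "successively (rch A) (({} # Xs @ [X]) @ [Y])"
    using assms(2) by (subst successively_append_iff) auto
  then have "successively (rch A) ({} # (Xs @ [X]) @ [Y])"
    by simp
  then show ?thesis
    unfolding reachable_def by blast
qed

lemma complete_if_rch: "rch A X Y \<Longrightarrow> complete A Y"
  unfolding rch_def complete_def by (cases A) (simp; meson subset_trans subsetD)

lemma complete_if_reachable:
  assumes "reachable A X"
  shows "complete A X"
proof -
  obtain Xs where "Xs \<noteq> []" and "successively (rch A) (({} # Xs) @ [X])"
    using assms unfolding reachable_def by auto
  then have "rch A (last Xs) X"
    by (subst (asm) successively_append_iff) auto
  then show ?thesis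
    by (rule complete_if_rch)
qed

text \<open>
  A maximal reachable subset \<open>S\<close> of a complete set \<open>X\<close> must be all of \<open>X\<close>. Otherwise, among the
  elements of \<open>X\<close> outside \<open>S\<close> and their depsets inside \<open>X\<close>, take a depset \<open>D\<close> of some \<open>e\<close> with as
  few elements outside \<open>S\<close> as possible. An element \<open>x\<close> of \<open>D\<close> outside \<open>S\<close> would have a depset inside
  \<open>D\<close> that avoids \<open>x\<close>, hence is better; so \<open>D \<subseteq> S\<close>, and \<open>insert e S\<close> is reachable as well.
\<close>

lemma reachable_if_complete:
  assumes dsc: "is_dsc A" and X: "complete A X"
  shows "reachable A X"
proof -
  obtain E dep where A: "A = (E, dep)"
    by (cases A)
  have finE: "finite E"
    and acyclic: "\<And>e D. \<lbrakk>e \<in> E; D \<in> dep e\<rbrakk> \<Longrightarrow> e \<notin> D"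
    and compl: "\<And>e D x. \<lbrakk>e \<in> E; D \<in> dep e; x \<in> D\<rbrakk> \<Longrightarrow> \<exists>D'\<in>dep x. D' \<subseteq> D"
    using dsc by (simp_all add: A is_dsc_def is_predsc_def acyclic_dep_def complete_depsets_def complete_def)
  have XE: "X \<subseteq> E" and Xdep: "\<And>e. e \<in> X \<Longrightarrow> \<exists>D\<in>dep e. D \<subseteq> X"
    using X unfolding A complete_def by auto
  have finX: "finite X"
    using XE finE by (rule finite_subset)
  define reach where "reach = {S. S \<subseteq> X \<and> reachable A S}"
  have "finite reach"
    using finX by (simp add: reach_def)
  moreover have "reach \<noteq> {}"
    using reachable_empty[of A] by (auto simp: reach_def)
  ultimately have "\<exists>S\<in>reach. \<forall>T\<in>reach. S \<subseteq> T \<longrightarrow> S = T"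
    by (rule finite_has_maximal)
  then obtain S where S: "S \<subseteq> X" "reachable A S"
    and S_max: "\<And>T. \<lbrakk>T \<subseteq> X; reachable A T; S \<subseteq> T\<rbrakk> \<Longrightarrow> S = T"
    by (auto simp: reach_def)
  have "S = X"
  proof (rule ccontr)
    assume "S \<noteq> X"
    then obtain e\<^sub>0 D\<^sub>0 where start: "e\<^sub>0 \<in> X - S \<and> D\<^sub>0 \<in> dep e\<^sub>0 \<and> D\<^sub>0 \<subseteq> X"
      using S Xdep by fast
    define ok where "ok = (\<lambda>(e, D). e \<in> X - S \<and> D \<in> dep e \<and> D \<subseteq> X)"
    have "ok (e\<^sub>0, D\<^sub>0)"
      using start by (simp add: ok_def)
    from ex_has_least_nat[where P = ok and m = "\<lambda>p. card (snd p - S)", OF this]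
    obtain p where p: "ok p" "\<And>q. ok q \<Longrightarrow> card (snd p - S) \<le> card (snd q - S)"
      by blast
    obtain e D where "p = (e, D)"
      by (cases p)
    with p have ok: "ok (e, D)"
      and least: "\<And>e' D'. ok (e', D') \<Longrightarrow> card (D - S) \<le> card (D' - S)"
      by (auto dest: p(2))
    have e: "e \<in> X" "e \<notin> S" and D: "D \<in> dep e" "D \<subseteq> X"
      using ok by (auto simp: ok_def)
    have "D \<subseteq> S"
    proof
      fix x assume x: "x \<in> D"
      show "x \<in> S"
      proof (rule ccontr)
        assume "x \<notin> S"
        obtain D' where D': "D' \<in> dep x" "D' \<subseteq> D"
          using compl[of e D x] x e D XE by blast
        have "x \<notin> D'"
          using acyclic[of x D'] D' x D XE by blast
        then have "D' - S \<subset> D - S"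
          using D' x \<open>x \<notin> S\<close> by blast
        moreover have "finite (D - S)"
          using D finX finite_subset by blast
        ultimately have "card (D' - S) < card (D - S)"
          by (rule psubset_card_mono[rotated])
        moreover have "ok (x, D')"
          using x \<open>x \<notin> S\<close> D D' by (auto simp: ok_def)
        ultimately show False
          using least[of x D'] by simp
      qed
    qed
    moreover have "complete A S"
      using S complete_if_reachable[of A S] by simp
    ultimately have "rch A S (insert e S)"
      unfolding A rch_def complete_def using e D XE by auto
    then have "reachable A (insert e S)"
      using S(2) reachable_step by blast
    then show False
      using S_max[of "insert e S"] S(1) e by blast
  qed
  then show ?thesis
    using S by simp
qed

lemma dsc_reachable_iff_complete: "is_dsc A \<Longrightarrow> reachable A X \<longleftrightarrow> complete A X"
  using complete_if_reachable reachable_if_complete by blast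

section \<open>Lower sets and monotone maps\<close>

definition lower_set :: "'a poset \<Rightarrow> 'a set \<Rightarrow> bool" where
  "lower_set = (\<lambda>(P, r) X. X \<subseteq> P \<and> (\<forall>x\<in>X. \<forall>y\<in>P. (y, x) \<in> r \<longrightarrow> y \<in> X))"

lemma lower_setD:
  "\<lbrakk>lower_set (P, r) X; x \<in> X; y \<in> P; (y, x) \<in> r\<rbrakk> \<Longrightarrow> y \<in> X"
  by (simp add: lower_set_def)

lemma monotone_iff_lower_set_vimage:
  assumes po: "partial_order_on Q s" and f: "f \<in> P \<rightarrow> Q"
  shows "monotone_on P (\<lambda>x y. (x, y) \<in> r) (\<lambda>x y. (x, y) \<in> s) f \<longleftrightarrow>
    (\<forall>X. lower_set (Q, s) X \<longrightarrow> lower_set (P, r) (f -` X \<inter> P))"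
proof
  assume "monotone_on P (\<lambda>x y. (x, y) \<in> r) (\<lambda>x y. (x, y) \<in> s) f"
  then show "\<forall>X. lower_set (Q, s) X \<longrightarrow> lower_set (P, r) (f -` X \<inter> P)"
    using f unfolding lower_set_def monotone_on_def by simp blast
next
  assume pre: "\<forall>X. lower_set (Q, s) X \<longrightarrow> lower_set (P, r) (f -` X \<inter> P)"
  show "monotone_on P (\<lambda>x y. (x, y) \<in> r) (\<lambda>x y. (x, y) \<in> s) f"
  proof (rule monotone_onI)
    fix x y assume xy: "x \<in> P" "y \<in> P" "(x, y) \<in> r"
    \<comment> \<open>The preimage of the principal lower set of \<open>f y\<close> contains \<open>y\<close>, hence also \<open>x\<close>.\<close>
    let ?down = "{z \<in> Q. (z, f y) \<in> s}"
    have "trans s" and "(f y, f y) \<in> s"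
      using po f xy by (auto simp: partial_order_on_def preorder_on_def refl_on_def)
    have "lower_set (Q, s) ?down"
      using \<open>trans s\<close> unfolding lower_set_def trans_def by blast
    then have "lower_set (P, r) (f -` ?down \<inter> P)"
      using pre by blast
    moreover have "y \<in> f -` ?down \<inter> P"
      using \<open>(f y, f y) \<in> s\<close> f xy by auto
    ultimately have "x \<in> f -` ?down \<inter> P"
      using xy(1,3) by (rule lower_setD)
    then show "(f x, f y) \<in> s"
      by simp
  qed
qed

section \<open>DSNCs and finite posets\<close>

text \<open>
  Writing \<open>d e\<close> for the only depset of \<open>e\<close> turns the axioms into conditions on a strict order:
  acyclicity is irreflexivity, and completeness of depsets is transitivity.
\<close>

lemma dsncE:
  assumes "is_dsnc A"
  obtains E dep d where "A = (E, dep)" and "finite E" and "dep \<in> extensional E"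
    and "\<And>e. e \<in> E \<Longrightarrow> dep e = {d e}" and "\<And>e. e \<in> E \<Longrightarrow> d e \<subseteq> E"
    and "\<And>e. e \<in> E \<Longrightarrow> e \<notin> d e"
    and "\<And>e x. \<lbrakk>e \<in> E; x \<in> d e\<rbrakk> \<Longrightarrow> d x \<subseteq> d e"
    and "on_obj R_functor A = (E, {(e', e). e' \<in> E \<and> e \<in> E \<and> (e' = e \<or> e' \<in> d e)})"
proof -
  obtain E dep where A: "A = (E, dep)"
    by (cases A)
  define d where "d e = the_elem (dep e)" for e
  have dep: "dep e = {d e}" if "e \<in> E" for e
    using assms that by (auto simp: A is_dsnc_def is_singleton_def d_def)
  have pre: "finite E" "dep \<in> extensional E" "\<And>e. e \<in> E \<Longrightarrow> dep e \<subseteq> Pow E"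
    using assms by (auto simp: A is_dsnc_def is_dsc_def is_predsc_def PiE_def)
  have dE: "d e \<subseteq> E" if "e \<in> E" for e
    using pre(3) dep that by fastforce
  have acyclic: "e \<notin> d e" if "e \<in> E" for e
    using assms that dep by (simp add: A is_dsnc_def is_dsc_def acyclic_dep_def)
  have mono: "d x \<subseteq> d e" if "e \<in> E" "x \<in> d e" for e x
  proof -
    have "complete (E, dep) (d e)"
      using assms that dep by (simp add: A is_dsnc_def is_dsc_def complete_depsets_def)
    then have "\<exists>D\<in>dep x. D \<subseteq> d e"
      using that(2) by (simp add: complete_def)
    moreover have "x \<in> E"
      using dE that by blast
    ultimately show ?thesis
      using dep by simp
  qed
  have R: "on_obj R_functor A = (E, {(e', e). e' \<in> E \<and> e \<in> E \<and> (e' = e \<or> e' \<in> d e)})"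
    using dep by (auto simp: A R_functor_def)
  show ?thesis
    by (rule that[OF A pre(1,2) dep dE acyclic mono R])
qed

lemma fst_R_obj [simp]: "fst (on_obj R_functor A) = fst A"
  by (cases A) (simp add: R_functor_def)

lemma fst_R_inv_obj [simp]: "fst (on_obj R_inv_functor P) = fst P"
  by (cases P) (simp add: R_inv_functor_def)

lemma is_finposet_R_obj:
  assumes "is_dsnc A"
  shows "is_finposet (on_obj R_functor A)"
  using assms
proof (cases rule: dsncE)
  case (1 E dep d)
  let ?r = "{(e', e). e' \<in> E \<and> e \<in> E \<and> (e' = e \<or> e' \<in> d e)}"
  have "refl_on E ?r" and "?r \<subseteq> E \<times> E"
    by (auto simp: refl_on_def)
  moreover have "trans ?r"
    using 1(7) unfolding trans_def by blast
  moreover have "antisym ?r"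
    using 1(6,7) unfolding antisym_def by blast
  ultimately have "partial_order_on E ?r"
    by (simp add: partial_order_on_def preorder_on_def)
  then show ?thesis
    using 1(2) by (simp add: 1(8) is_finposet_def)
qed

lemma complete_iff_lower_set:
  assumes "is_dsnc A"
  shows "complete A X \<longleftrightarrow> lower_set (on_obj R_functor A) X"
  using assms
proof (cases rule: dsncE)
  case (1 E dep d)
  have "complete A X \<longleftrightarrow> X \<subseteq> E \<and> (\<forall>e\<in>X. d e \<subseteq> X)"
    using 1(4) by (auto simp: 1(1) complete_def subset_iff)
  also have "\<dots> \<longleftrightarrow> lower_set (on_obj R_functor A) X"
    unfolding 1(8) lower_set_def
    using 1(5) by simp blast
  finally show ?thesis .
qed

lemma dsc_hom_eq_poset_hom:
  assumes A: "is_dsnc A" and B: "is_dsnc B"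
  shows "dsc_hom A B = poset_hom (on_obj R_functor A) (on_obj R_functor B)"
proof -
  obtain P r Q s where P: "on_obj R_functor A = (P, r)" and Q: "on_obj R_functor B = (Q, s)"
    by (meson surj_pair)
  have fst: "fst A = P" "fst B = Q"
    using fst_R_obj[of A] fst_R_obj[of B] by (simp_all add: P Q)
  have po: "partial_order_on Q s"
    using is_finposet_R_obj[OF B] by (simp add: Q is_finposet_def)
  have reach: "reachable A X \<longleftrightarrow> lower_set (P, r) X" "reachable B X \<longleftrightarrow> lower_set (Q, s) X" for X
    using A B complete_iff_lower_set[of A X] complete_iff_lower_set[of B X]
    by (simp_all add: is_dsnc_def dsc_reachable_iff_complete P Q)
  have sub: "X \<subseteq> Q" if "lower_set (Q, s) X" for X
    using that by (simp add: lower_set_def)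
  have "f \<in> dsc_hom A B \<longleftrightarrow> f \<in> poset_hom (P, r) (Q, s)" for f
  proof (cases "f \<in> P \<rightarrow>\<^sub>E Q")
    case True
    then have "f \<in> P \<rightarrow> Q"
      by (simp add: PiE_def)
    from monotone_iff_lower_set_vimage[OF po this, of r] show ?thesis
      using True sub by (auto simp: dsc_hom_def poset_hom_def fst reach)
  next
    case False
    then show ?thesis
      by (simp add: dsc_hom_def poset_hom_def fst)
  qed
  then show ?thesis
    unfolding P Q by blast
qed

lemma is_dsnc_R_inv_obj:
  assumes "is_finposet P"
  shows "is_dsnc (on_obj R_inv_functor P)"
proof -
  obtain S r where P: "P = (S, r)"
    by (cases P)
  have fin: "finite S" and "trans r" and "antisym r"
    using assms by (simp_all add: P is_finposet_def partial_order_on_def preorder_on_def)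
  let ?below = "\<lambda>a. {b \<in> S. (b, a) \<in> r \<and> b \<noteq> a}"
  have below: "?below x \<subseteq> ?below a" if "x \<in> ?below a" for a x
  proof
    fix c assume "c \<in> ?below x"
    \<comment> \<open>If \<open>c = a\<close>, then \<open>x\<close> and \<open>a\<close> lie below each other and hence agree.\<close>
    then have "c \<in> S" and "(c, a) \<in> r" and "c \<noteq> a"
      using that transD[OF \<open>trans r\<close>, of c x a] antisymD[OF \<open>antisym r\<close>, of a x] by auto
    then show "c \<in> ?below a"
      by blast
  qed
  have "complete_depsets (S, \<lambda>a\<in>S. {?below a})"
    using below by (simp add: complete_depsets_def complete_def)
  then show ?thesis
    using fin by (simp add: P R_inv_functor_def is_dsnc_def is_dsc_def is_predsc_def
        irredundant_def acyclic_dep_def nonsingular_def)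
qed

lemma R_inv_R_obj:
  assumes "is_dsnc A"
  shows "on_obj R_inv_functor (on_obj R_functor A) = A"
  using assms
proof (cases rule: dsncE)
  case (1 E dep d)
  have below: "{b \<in> E. (b \<in> E \<and> a \<in> E \<and> (b = a \<or> b \<in> d a)) \<and> b \<noteq> a} = d a" if "a \<in> E" for a
    using that 1(5,6) by blast
  have "(\<lambda>a\<in>E. {{b \<in> E. (b \<in> E \<and> a \<in> E \<and> (b = a \<or> b \<in> d a)) \<and> b \<noteq> a}}) = dep"
  proof (rule extensionalityI)
    show "dep \<in> extensional E"
      by (rule 1(3))
  qed (use below 1(4) in auto)
  then show ?thesis
    unfolding 1(8) by (simp add: R_inv_functor_def 1(1))
qed

lemma R_R_inv_obj:
  assumes "is_finposet P"
  shows "on_obj R_functor (on_obj R_inv_functor P) = P"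
proof -
  obtain S r where P: "P = (S, r)"
    by (cases P)
  have "r \<subseteq> S \<times> S" and "refl_on S r"
    using assms by (simp_all add: P is_finposet_def partial_order_on_def preorder_on_def)
  then show ?thesis
    by (auto simp: P R_functor_def R_inv_functor_def refl_on_def)
qed

section \<open>The categories and the isomorphism\<close>

text \<open>
  When morphisms are functions, the unit and associativity laws hold by themselves; only closure
  under identities and composition depends on the category. The values \<open>undefined\<close> outside the
  domain are what makes the unit laws hold as equations.
\<close>

lemma is_category_of_functions:
  assumes "\<And>X Y. hom C X Y \<subseteq> fst X \<rightarrow>\<^sub>E fst Y"
    and "ide C = (\<lambda>X. \<lambda>x\<in>fst X. x)"
    and "cmp C = (\<lambda>X Y Z g f. compose (fst X) g f)"
    and "\<And>X. X \<in> obj C \<Longrightarrow> (\<lambda>x\<in>fst X. x) \<in> hom C X X"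
    and "\<And>X Y Z f g. \<lbrakk>X \<in> obj C; Y \<in> obj C; Z \<in> obj C; f \<in> hom C X Y; g \<in> hom C Y Z\<rbrakk> \<Longrightarrow>
      compose (fst X) g f \<in> hom C X Z"
  shows "is_category C"
proof -
  have fn: "f \<in> fst X \<rightarrow> fst Y" "f \<in> extensional (fst X)" if "f \<in> hom C X Y" for X Y f
    using subsetD[OF assms(1) that] by (simp_all add: PiE_def)
  show ?thesis
    unfolding is_category_def assms(2,3)
  proof (intro conjI ballI)
    fix X Y f assume "f \<in> hom C X Y"
    from fn[OF this] show "compose (fst X) f (\<lambda>x\<in>fst X. x) = f"
      and "compose (fst X) (\<lambda>x\<in>fst Y. x) f = f"
      by (rule compose_Id, rule Id_compose)
  next
    fix W X Y Z f g h assume "f \<in> hom C W X"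
    from fn(1)[OF this]
    show "compose (fst W) h (compose (fst W) g f) = compose (fst W) (compose (fst X) h g) f"
      by (rule compose_assoc)
  qed (use assms(4,5) in blast)+
qed

lemma DSNC_simps [simp]:
  "obj DSNC = {A. is_dsnc A}" "hom DSNC = dsc_hom"
  "ide DSNC = (\<lambda>A. \<lambda>x\<in>fst A. x)" "cmp DSNC = (\<lambda>A B C g f. compose (fst A) g f)"
  by (auto simp: DSNC_def DSC_def full_subcategory_def is_dsnc_def)

lemma FinPos_simps [simp]:
  "obj FinPos = {P. is_finposet P}" "hom FinPos = poset_hom"
  "ide FinPos = (\<lambda>P. \<lambda>x\<in>fst P. x)" "cmp FinPos = (\<lambda>P Q R g f. compose (fst P) g f)"
  by (simp_all add: FinPos_def)

lemma on_mor_R [simp]: "on_mor R_functor A B f = f" "on_mor R_inv_functor P Q f = f"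
  by (simp_all add: R_functor_def R_inv_functor_def)

lemma is_category_FinPos: "is_category FinPos"
proof (rule is_category_of_functions)
  show "hom FinPos X Y \<subseteq> fst X \<rightarrow>\<^sub>E fst Y" for X Y :: "'a poset"
    by (auto simp: poset_hom_def split: prod.splits)
  show "(\<lambda>x\<in>fst X. x) \<in> hom FinPos X X" for X :: "'a poset"
    by (auto simp: poset_hom_def monotone_on_def split: prod.splits)
  show "compose (fst X) g f \<in> hom FinPos X Z"
    if "f \<in> hom FinPos X Y" "g \<in> hom FinPos Y Z" for X Y Z :: "'a poset" and f g
    using that by (cases X; cases Y; cases Z)
      (fastforce simp: poset_hom_def monotone_on_def compose_def)
qed simp_all

text \<open>
  The DSC morphisms between DSNCs being the monotone maps, closure under identities and
  composition carries over from posets.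
\<close>

lemma is_category_DSNC: "is_category (DSNC :: ('a predsc, 'a \<Rightarrow> 'a) cat)"
proof (rule is_category_of_functions)
  show "hom DSNC X Y \<subseteq> fst X \<rightarrow>\<^sub>E fst Y" for X Y :: "'a predsc"
    by (auto simp: dsc_hom_def)
  show "(\<lambda>x\<in>fst X. x) \<in> hom DSNC X X" if X: "X \<in> obj DSNC" for X :: "'a predsc"
  proof -
    have "on_obj R_functor X \<in> obj FinPos"
      using X by (simp add: is_finposet_R_obj)
    then have "ide FinPos (on_obj R_functor X) \<in> hom FinPos (on_obj R_functor X) (on_obj R_functor X)"
      using is_category_FinPos unfolding is_category_def by blast
    then show ?thesis
      using X by (simp add: dsc_hom_eq_poset_hom)
  qed
  show "compose (fst X) g f \<in> hom DSNC X Z"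
    if obj: "X \<in> obj DSNC" "Y \<in> obj DSNC" "Z \<in> obj DSNC"
      and f: "f \<in> hom DSNC X Y" and g: "g \<in> hom DSNC Y Z" for X Y Z :: "'a predsc" and f g
  proof -
    let ?R = "on_obj R_functor"
    have "?R X \<in> obj FinPos" "?R Y \<in> obj FinPos" "?R Z \<in> obj FinPos"
      using obj by (simp_all add: is_finposet_R_obj)
    moreover have "f \<in> hom FinPos (?R X) (?R Y)" "g \<in> hom FinPos (?R Y) (?R Z)"
      using f g obj by (simp_all add: dsc_hom_eq_poset_hom)
    ultimately have "cmp FinPos (?R X) (?R Y) (?R Z) g f \<in> hom FinPos (?R X) (?R Z)"
      using is_category_FinPos unfolding is_category_def by blast
    then show ?thesis
      using obj by (simp add: dsc_hom_eq_poset_hom)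
  qed
qed simp_all

lemma is_functor_R: "is_functor DSNC FinPos R_functor"
  unfolding is_functor_def
  by (simp add: is_category_DSNC is_category_FinPos is_finposet_R_obj dsc_hom_eq_poset_hom)

lemma is_functor_R_inv: "is_functor FinPos DSNC R_inv_functor"
  unfolding is_functor_def
  by (simp add: is_category_DSNC is_category_FinPos is_dsnc_R_inv_obj dsc_hom_eq_poset_hom
      R_R_inv_obj)

theorem proposition4p5:
  shows "isomorphism_of_categories
           (DSNC :: ('a predsc, 'a \<Rightarrow> 'a) cat) (FinPos :: ('a poset, 'a \<Rightarrow> 'a) cat)
           R_functor R_inv_functor"
  unfolding isomorphism_of_categories_def eq_functor_def comp_functor_def id_functor_def
  by (simp add: is_functor_R is_functor_R_inv R_inv_R_obj R_R_inv_obj)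

end
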